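(* Let $0 \le \Delta < 1$ and $a > 0$, and let $\eta_t=\{l_t,r_t\}$ be the two-point linear edge-reinforced process on $\mathbb{Z}$ with drift $\Delta$ and initial edge weight $a$, started from $l_0 < r_0$. Let $\tau_1 = \inf\{t \ge 0 : l_t = r_t\}$ be the first meeting time of the two particles. Then $\tau_1 < \infty$ almost surely.
   Context: The two-point linear edge-reinforced process on $\mathbb{Z}$ with drift $\Delta \ge 0$ and initial weight $a>0$ is defined as follows. Every edge $[v,v+1]$, $v\in\mathbb{Z}$, carries a weight $W_t(v,v+1)$, with $W_0(v,v+1)=a$ for all $v$. Two particles move on $\mathbb{Z}$; each carries an independent rate-one exponential clock (independent exponential waiting times with rate one between its jumps). When the clock of a particle located at site $v$ rings at time $t$, the particle jumps to $v+1$ with probability $$\frac{W_{t-}(v,v+1)+\Delta}{W_{t-}(v-1,v)+W_{t-}(v,v+1)+\Delta}$$ and to $v-1$ with probability $$\frac{W_{t-}(v-1,v)}{W_{t-}(v-1,v)+W_{t-}(v,v+1)+\Delta},$$ and the weight of the traversed edge is increased by $1$ (all other weights unchanged). The weights are shared by both particles. Denote by $l_t$ the position of the left particle and by $r_t$ that of the right particle at time $t$ (so $l_t \le r_t$; when $l_t=r_t$ the labels are immaterial). *)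

theory Defs
  imports "HOL-Probability.Probability"
begin

text \<open>Realisation of the two-point linear edge-reinforced process on the integers.
  Particles are labelled by bool: False = initially left particle, True = initially
  right particle.  E i k is the (k+1)-th exponential waiting time of particle i,
  U i k is the uniform variable deciding the direction of the (k+1)-th jump of
  particle i.  W v is the weight of the edge [v, v+1].\<close>

definition clock :: "(bool \<Rightarrow> nat \<Rightarrow> real) \<Rightarrow> bool \<Rightarrow> nat \<Rightarrow> real" where
  "clock E i k = (\<Sum>j\<le>k. E i j)"

type_synonym lerp_state = "(bool \<Rightarrow> int) \<times> (int \<Rightarrow> real) \<times> (bool \<Rightarrow> nat)"

text \<open>State after the k-th jump of the merged (both particles) jump sequence:
  positions, edge weights, number of jumps made by each particle.\<close>
fun lerp_chain :: "real \<Rightarrow> real \<Rightarrow> int \<Rightarrow> int \<Rightarrow> (bool \<Rightarrow> nat \<Rightarrow> real)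
    \<Rightarrow> (bool \<Rightarrow> nat \<Rightarrow> real) \<Rightarrow> nat \<Rightarrow> lerp_state" where
  "lerp_chain \<Delta> a l0 r0 E U 0 = ((\<lambda>i. if i then r0 else l0), (\<lambda>_. a), (\<lambda>_. 0))"
| "lerp_chain \<Delta> a l0 r0 E U (Suc k) =
     (case lerp_chain \<Delta> a l0 r0 E U k of (x, W, c) \<Rightarrow>
        let i = (clock E True (c True) < clock E False (c False));
            v = x i;
            p = (W v + \<Delta>) / (W (v - 1) + W v + \<Delta>)
        in if U i (c i) < p
           then (x(i := v + 1), W(v := W v + 1), c(i := c i + 1))
           else (x(i := v - 1), W(v - 1 := W (v - 1) + 1), c(i := c i + 1)))"

text \<open>Time of the (k+1)-th jump of the merged sequence (the earlier of the two
  pending clock rings).\<close>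
definition lerp_jumptime :: "real \<Rightarrow> real \<Rightarrow> int \<Rightarrow> int \<Rightarrow> (bool \<Rightarrow> nat \<Rightarrow> real)
    \<Rightarrow> (bool \<Rightarrow> nat \<Rightarrow> real) \<Rightarrow> nat \<Rightarrow> real" where
  "lerp_jumptime \<Delta> a l0 r0 E U k =
     (case lerp_chain \<Delta> a l0 r0 E U k of (x, W, c) \<Rightarrow>
        min (clock E False (c False)) (clock E True (c True)))"

definition lerp_pos :: "real \<Rightarrow> real \<Rightarrow> int \<Rightarrow> int \<Rightarrow> (bool \<Rightarrow> nat \<Rightarrow> real)
    \<Rightarrow> (bool \<Rightarrow> nat \<Rightarrow> real) \<Rightarrow> real \<Rightarrow> bool \<Rightarrow> int" where
  "lerp_pos \<Delta> a l0 r0 E U t i =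
     fst (lerp_chain \<Delta> a l0 r0 E U (card {k. lerp_jumptime \<Delta> a l0 r0 E U k \<le> t})) i"

text \<open>First meeting time (infimum of the empty set is \<infinity>).\<close>
definition lerp_meet_time :: "real \<Rightarrow> real \<Rightarrow> int \<Rightarrow> int \<Rightarrow> (bool \<Rightarrow> nat \<Rightarrow> real)
    \<Rightarrow> (bool \<Rightarrow> nat \<Rightarrow> real) \<Rightarrow> ereal" where
  "lerp_meet_time \<Delta> a l0 r0 E U =
     (INF t \<in> {t. 0 \<le> t \<and> lerp_pos \<Delta> a l0 r0 E U t False = lerp_pos \<Delta> a l0 r0 E U t True}. ereal t)"

end

theory Submission
  imports Defs
begin

text \<open>
  Call \<open>\<Phi>\<close> the sum of the inverse weights of the edges between the two particles, that is, the
  effective resistance between them. Until the meeting \<open>\<Phi>\<close> is a nonnegative supermartingale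
  (Davis' argument for a single particle): a step towards the other particle removes \<open>1 / W\<close>, a step
  away only adds \<open>1 / (W + 1)\<close>. It decreases in mean by at least the drift
  \<open>(1 - \<Delta>) / ((W\<^sub>o + 1) * (W\<^sub>- + W\<^sub>+ + \<Delta>))\<close>, where \<open>W\<^sub>o\<close> is the weight of the
  outward edge at the moving particle and \<open>W\<^sub>-\<close>, \<open>W\<^sub>+\<close> are those of its two edges. Hence almost
  surely the drifts up to the meeting have a finite sum.

  No infinite path without a meeting has a finite drift sum. While a particle does not get
  beyond a site \<open>v\<close>, every jump from \<open>v\<close> raises the weight of the edge below \<open>v\<close> by 2 in total and
  the drifts at these jumps are inversely proportional to that weight up to constants, so their sum
  controls its logarithm. A fresh extremal site thus costs a fixed amount of drift before it is
  passed, whence both particles stay in a bounded region; and infinitely many jumps from the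
  extremal site that is left infinitely often would cost an infinite amount.

  The order of the jumps is a function of the exponential clocks only, so it is independent of the
  uniform variables, and nothing else about it matters.
\<close>

subsection \<open>The outermost site of a particle\<close>

text \<open>A pathwise setting with the outward direction upwards: the right particle fits directly,
  the left one after reflection. \<open>stay\<close> covers the jumps of the other particle, which
  lies strictly inside and never crosses the edge at \<open>y k - 1\<close> or a higher one.
  \<open>d\<close> also counts the drifts of those jumps.\<close>

locale outward_particle =
  fixes y :: "nat \<Rightarrow> int" and w :: "nat \<Rightarrow> int \<Rightarrow> real" and J :: "nat \<Rightarrow> bool"
    and \<Delta> a :: real and d :: "nat \<Rightarrow> real"
  assumes jump: "J k \<Longrightarrow>
      (y (Suc k) = y k + 1 \<and> w (Suc k) = (w k)(y k := w k (y k) + 1)) \<or>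
      (y (Suc k) = y k - 1 \<and> w (Suc k) = (w k)(y k - 1 := w k (y k - 1) + 1))"
    and stay: "\<not> J k \<Longrightarrow> y (Suc k) = y k \<and> (\<forall>v \<ge> y k - 1. w (Suc k) v = w k v)"
    and w_init: "w 0 v = a"
    and w_pos: "0 < w k v"
    and drift: "J k \<Longrightarrow> d k = (1 - \<Delta>) / ((w k (y k) + 1) * (w k (y k - 1) + w k (y k) + \<Delta>))"
    and drift_nonneg: "0 \<le> d k"
    and drift_summable: "summable d"
    and \<Delta>_nonneg: "0 \<le> \<Delta>" and \<Delta>_less_1: "\<Delta> < 1"
begin

lemma weight_beyond_const:
  assumes "K \<le> n" and "\<And>j. K \<le> j \<Longrightarrow> j \<le> n \<Longrightarrow> y j \<le> v"
  shows "w n v = w K v"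
  using assms
proof (induction n rule: dec_induct)
  case (step n)
  have "y n \<le> v" "y (Suc n) \<le> v" using step.prems step.hyps by auto
  hence "w (Suc n) v = w n v" using jump[of n] stay[of n] by (cases "J n") auto
  with step show ?case by auto
qed simp

text \<open>The weight of the edge below \<open>v\<close>, corrected so that it grows (by 2) only when the particle
  jumps away from \<open>v\<close>.\<close>
definition exit_weight :: "int \<Rightarrow> nat \<Rightarrow> real" where
  "exit_weight v k = w k (v - 1) - (if y k = v then 1 else 0)"

lemma exit_weight_gt: "- 1 < exit_weight v k"
  using w_pos[of k "v - 1"] by (auto simp: exit_weight_def)

text \<open>An arrival at \<open>v\<close> from below adds 1 to the edge weight, which the
  correction cancels; a departure downwards adds 1 and lifts the correction. A departure upwards is
  excluded by \<open>y (Suc k) \<le> v\<close>.\<close>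

lemma exit_weight_Suc:
  assumes "y k \<le> v" "y (Suc k) \<le> v"
  shows "exit_weight v (Suc k) = exit_weight v k + (if J k \<and> y k = v then 2 else 0)"
proof (cases "J k")
  case True
  consider (up) "y (Suc k) = y k + 1" "w (Suc k) = (w k)(y k := w k (y k) + 1)"
    | (down) "y (Suc k) = y k - 1" "w (Suc k) = (w k)(y k - 1 := w k (y k - 1) + 1)"
    using jump[OF True] by blast
  thus ?thesis
  proof cases
    case up
    show ?thesis using assms True unfolding exit_weight_def up by (cases "y k = v - 1") auto
  next
    case down
    show ?thesis using assms True unfolding exit_weight_def down by (cases "y k = v") auto
  qed
next
  case False
  with assms stay[OF False] show ?thesis by (simp add: exit_weight_def)
qed

text \<open>At a jump from \<open>v\<close> the correction is 1, so the shift
  \<open>1 + b + \<Delta>\<close> turns the exit weight into the sum \<open>Q\<close> in the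
  denominator of the drift, and ln (1 + 2 / Q) is at most 2 / Q. Writing
  \<open>exit_weight v k + 2\<close> instead of \<open>exit_weight v (Suc k)\<close> covers jumps
  upwards as well.\<close>

lemma ln_increment_le_drift:
  assumes "J k" "y k = v" and b: "w k v = b"
  shows "ln (exit_weight v k + 2 + (1 + b + \<Delta>)) \<le> ln (exit_weight v k + (1 + b + \<Delta>)) + 2 * (b + 1) / (1 - \<Delta>) * d k"
proof -
  define Q where "Q = exit_weight v k + (1 + b + \<Delta>)"
  have b0: "0 < b" using w_pos[of k v] b by simp
  have Q: "Q > 0" using exit_weight_gt[of v k] b0 \<Delta>_nonneg by (simp add: Q_def)
  have "ln (Q + 2) - ln Q = ln (1 + 2 / Q)"
    using Q ln_div[of "Q + 2" Q] by (simp add: add_divide_distrib)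
  also have "\<dots> \<le> 2 / Q" using Q by (intro ln_add_one_self_le_self) auto
  also have "\<dots> = 2 * (b + 1) / (1 - \<Delta>) * d k"
  proof -
    have "d k = (1 - \<Delta>) / ((b + 1) * Q)"
      using drift[OF assms(1)] assms by (simp add: Q_def exit_weight_def algebra_simps)
    thus ?thesis using Q b0 \<Delta>_less_1 by (simp add: divide_simps) (simp add: algebra_simps)
  qed
  finally show ?thesis by (simp add: Q_def algebra_simps)
qed

text \<open>The previous bound is summed over the jumps from \<open>v\<close>: the outward weight
  stays \<open>b\<close> while the particle is not beyond \<open>v\<close>, and at all other steps
  the exit weight is constant and \<open>d\<close> nonnegative.\<close>

lemma ln_exit_weight_le:
  assumes "K \<le> n" and "\<And>j. K \<le> j \<Longrightarrow> j \<le> n \<Longrightarrow> y j \<le> v" and b: "w K v = b"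
  shows "ln (exit_weight v n + (1 + b + \<Delta>)) \<le>
    ln (exit_weight v K + (1 + b + \<Delta>)) + 2 * (b + 1) / (1 - \<Delta>) * (\<Sum>j\<in>{K..<n}. d j)"
proof -
  define C where "C = 2 * (b + 1) / (1 - \<Delta>)"
  have C: "0 \<le> C" using w_pos[of K v] b \<Delta>_less_1 by (simp add: C_def)
  show ?thesis
    using assms(1,2) unfolding C_def[symmetric]
  proof (induction n rule: dec_induct)
    case (step n)
    have le: "y n \<le> v" "y (Suc n) \<le> v" using step.prems step.hyps by auto
    have bn: "w n v = b" using weight_beyond_const[of K n v] step b by auto
    have "ln (exit_weight v (Suc n) + (1 + b + \<Delta>)) \<le> ln (exit_weight v n + (1 + b + \<Delta>)) + C * d n"
      using exit_weight_Suc[OF le] ln_increment_le_drift[of n v b] bn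
        mult_nonneg_nonneg[OF C drift_nonneg[of n]]
      by (auto simp: C_def split: if_splits)
    also have "ln (exit_weight v n + (1 + b + \<Delta>)) \<le>
        ln (exit_weight v K + (1 + b + \<Delta>)) + C * (\<Sum>j\<in>{K..<n}. d j)"
      using step by auto
    finally show ?case using step.hyps by (simp add: distrib_left)
  qed simp
qed

text \<open>Once the remaining drift is below the cost of passing a fresh site, the next fresh site
  is never passed.\<close>

lemma bounded_above: "\<exists>B. \<forall>k. y k \<le> B"
proof -
  define A where "A = 1 + a + \<Delta>"
  define C where "C = 2 * (a + 1) / (1 - \<Delta>)"
  have a: "0 < a" using w_pos[of 0] w_init by simp
  have A: "0 < A" using a \<Delta>_nonneg by (simp add: A_def)
  have C: "0 < C" using a \<Delta>_less_1 by (simp add: C_def)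
  \<comment> \<open>The drift that it costs to raise the exit weight of a fresh site from
    \<open>a\<close> to \<open>a + 2\<close>.\<close>
  define \<epsilon> where "\<epsilon> = (ln (a + 2 + A) - ln (a + A)) / C"
  have "\<epsilon> > 0" using a A C by (simp add: \<epsilon>_def)
  then obtain K where K: "\<And>m n. K \<le> m \<Longrightarrow> norm (\<Sum>j\<in>{m..<n}. d j) < \<epsilon>"
    using drift_summable unfolding summable_Cauchy by meson
  \<comment> \<open>One above the range up to time \<open>K\<close>, so both edges at
    \<open>v\<close> still have weight \<open>a\<close> then.\<close>
  define v where "v = Max (y ` {..K}) + 1"
  have below: "y j \<le> v - 1" if "j \<le> K" for j
    using that by (auto simp: v_def)
  have "y k \<le> v" for k
  proof (rule ccontr)
    assume "\<not> y k \<le> v"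
    hence ex: "\<exists>k. y k > v" by (meson not_le)
    define m where "m = (LEAST k. y k > v)"
    have m: "y m > v" unfolding m_def by (rule LeastI_ex[OF ex])
    have before: "y j \<le> v" if "j < m" for j
      using not_less_Least[of j "\<lambda>k. y k > v"] that by (auto simp: m_def)
    have "m > K" using m below[of m] by (cases "m \<le> K") auto
    then obtain n where n: "m = Suc n" "K \<le> n" by (cases m) auto
    have yn: "J n" "y n = v" using m before[of n] jump[of n] stay[of n] n by (cases "J n"; force)+
    have wK: "w K v = a"
      using weight_beyond_const[of 0 K v] below w_init by force
    have wK': "w K (v - 1) = a"
      using weight_beyond_const[of 0 K "v - 1"] below w_init by force
    have wn: "w n v = a" using weight_beyond_const[of K n v] wK before n by auto
    have eK: "exit_weight v K = a" using wK' below[of K] by (simp add: exit_weight_def)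
    have 1: "ln (exit_weight v n + A) \<le> ln (a + A) + C * (\<Sum>j\<in>{K..<n}. d j)"
      using ln_exit_weight_le[of K n v a] wK n before eK by (auto simp: A_def C_def)
    \<comment> \<open>The jump beyond \<open>v\<close> is charged as if it too had raised the exit
      weight by 2.\<close>
    have 2: "ln (exit_weight v n + 2 + A) \<le> ln (exit_weight v n + A) + C * d n"
      using ln_increment_le_drift[OF yn wn] by (simp add: A_def C_def)
    have mono: "exit_weight v j \<ge> a" if "K \<le> j" "j \<le> n" for j
      using that
    proof (induction j rule: dec_induct)
      case base thus ?case using eK by simp
    next
      case (step j) thus ?case using exit_weight_Suc[of j v] before n by auto
    qed
    have "ln (a + 2 + A) \<le> ln (exit_weight v n + 2 + A)"
      using mono[of n] n a A by simp
    also have "\<dots> \<le> ln (a + A) + C * (\<Sum>j\<in>{K..<Suc n}. d j)"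
      using 1 2 n by (simp add: algebra_simps)
    also have "\<dots> < ln (a + A) + C * \<epsilon>"
      using K[of K "Suc n"] C by auto
    also have "\<dots> = ln (a + 2 + A)" using C by (simp add: \<epsilon>_def)
    finally show False by simp
  qed
  thus ?thesis by blast
qed

text \<open>In a bounded range, infinitely many jumps leave some site infinitely often. At the
  highest such site the logarithm of the exit weight would be unbounded, against the finite total
  drift.\<close>

lemma finitely_many_jumps:
  assumes lower: "\<And>k. L \<le> y k"
  shows "finite {k. J k}"
proof (rule ccontr)
  assume inf: "infinite {k. J k}"
  obtain B where B: "\<And>k. y k \<le> B" using bounded_above by blast
  define V where "V = {v. infinite {k. J k \<and> y k = v}}"
  have V_sub: "V \<subseteq> {L..B}"
  proof
    fix v assume "v \<in> V"
    hence "{k. J k \<and> y k = v} \<noteq> {}" unfolding V_def by (metis (mono_tags, lifting) finite.emptyI mem_Collect_eq)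
    thus "v \<in> {L..B}" using lower B by auto
  qed
  have "V \<noteq> {}"
  proof
    assume "V = {}"
    hence "finite (\<Union>v\<in>{L..B}. {k. J k \<and> y k = v})" by (auto simp: V_def)
    moreover have "{k. J k} \<subseteq> (\<Union>v\<in>{L..B}. {k. J k \<and> y k = v})" using lower B by auto
    ultimately show False using inf finite_subset by blast
  qed
  define v where "v = Max V"
  have vV: "v \<in> V" unfolding v_def using V_sub \<open>V \<noteq> {}\<close> finite_subset by (intro Max_in) auto
  have above: "u \<notin> V" if "u > v" for u
    using that Max_ge[of V u] finite_subset[OF V_sub] unfolding v_def by fastforce
  have inf_v: "infinite {k. J k \<and> y k = v}" using vV by (simp add: V_def)
  have "finite (\<Union>u\<in>{v<..B}. {k. J k \<and> y k = u})" using above by (auto simp: V_def)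
  moreover have "{k. J k \<and> v < y k} \<subseteq> (\<Union>u\<in>{v<..B}. {k. J k \<and> y k = u})" using B by auto
  ultimately have "finite {k. J k \<and> v < y k}" by (rule rev_finite_subset)
  then obtain K0 where K0: "\<And>k. J k \<Longrightarrow> v < y k \<Longrightarrow> k < K0"
    unfolding finite_nat_set_iff_bounded by blast
  text \<open>From time \<open>K0\<close> on, a particle above \<open>v\<close> would be stuck there.\<close>
  have le_v: "y k \<le> v" if "K0 \<le> k" for k
  proof (rule ccontr)
    assume k: "\<not> y k \<le> v"
    have const: "y j = y k" if "k \<le> j" for j
      using that
    proof (induction j rule: dec_induct)
      case (step j)
      have "\<not> J j" using K0[of j] step \<open>K0 \<le> k\<close> k by auto
      thus ?case using stay[of j] step by simp
    qed simp
    have "{k. J k \<and> y k = v} \<subseteq> {..<k}" 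
    proof
      fix j assume "j \<in> {k. J k \<and> y k = v}"
      thus "j \<in> {..<k}" using const[of j] k by (cases "k \<le> j") auto
    qed
    thus False using inf_v finite_subset by blast
  qed
  define b where "b = w K0 v"
  define A where "A = 1 + b + \<Delta>"
  define C where "C = 2 * (b + 1) / (1 - \<Delta>)"
  define T where "T = ln (exit_weight v K0 + A) + C * suminf d"
  have b0: "0 < b" using w_pos by (simp add: b_def)
  have C0: "0 \<le> C" using b0 \<Delta>_less_1 by (simp add: C_def)
  have "ln (exit_weight v n + A) \<le> T" if "K0 \<le> n" for n
  proof -
    have "(\<Sum>j\<in>{K0..<n}. d j) \<le> suminf d"
      by (rule sum_le_suminf[OF drift_summable]) (auto simp: drift_nonneg)
    hence "C * (\<Sum>j\<in>{K0..<n}. d j) \<le> C * suminf d" using C0 by (rule mult_left_mono)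
    thus ?thesis
      using ln_exit_weight_le[OF that, of v b] le_v by (auto simp: A_def C_def b_def T_def)
  qed
  moreover have "0 < exit_weight v n + A" for n
    using exit_weight_gt[of v n] b0 \<Delta>_nonneg by (simp add: A_def)
  ultimately have upper: "exit_weight v n + A \<le> exp T" if "K0 \<le> n" for n
    using that by (metis exp_le_cancel_iff exp_ln)
  have grow: "exit_weight v n \<ge> exit_weight v K0 + 2 * real (card {k\<in>{K0..<n}. J k \<and> y k = v})"
    if "K0 \<le> n" for n
    using that
  proof (induction n rule: dec_induct)
    case (step n)
    have *: "{k \<in> {K0..<Suc n}. J k \<and> y k = v} =
      (if J n \<and> y n = v then insert n {k \<in> {K0..<n}. J k \<and> y k = v} else {k \<in> {K0..<n}. J k \<and> y k = v})"
      using step.hyps by (auto simp: less_Suc_eq)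
    have "y n \<le> v" "y (Suc n) \<le> v" using le_v step.hyps by simp_all
    from exit_weight_Suc[OF this] step.IH show ?case unfolding * by (cases "J n \<and> y n = v") auto
  qed simp
  \<comment> \<open>After \<open>N\<close> jumps from \<open>v\<close> the shifted exit weight
    exceeds \<open>2 * N\<close>, hence \<open>exp T\<close>.\<close>
  obtain N :: nat where N: "real N > exp T" using reals_Archimedean2 by blast
  have "infinite ({k. J k \<and> y k = v} - {..<K0})" using inf_v by simp
  then obtain F where F: "F \<subseteq> {k. J k \<and> y k = v} - {..<K0}" "finite F" "card F = N"
    using infinite_arbitrarily_large by blast
  define n where "n = max K0 (Suc (Max (insert 0 F)))"
  have "F \<subseteq> {k\<in>{K0..<n}. J k \<and> y k = v}"
  proof
    fix k assume k: "k \<in> F"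
    hence "k \<le> Max (insert 0 F)" using F by (intro Max_ge) auto
    hence "k < n" unfolding n_def by linarith
    thus "k \<in> {k\<in>{K0..<n}. J k \<and> y k = v}" using F k by auto
  qed
  hence "N \<le> card {k\<in>{K0..<n}. J k \<and> y k = v}"
    using F card_mono[of "{k\<in>{K0..<n}. J k \<and> y k = v}" F] by auto
  moreover have "K0 \<le> n" by (simp add: n_def)
  ultimately have "exit_weight v n \<ge> exit_weight v K0 + 2 * real N" using grow[of n] by linarith
  with upper[of n] exit_weight_gt[of v K0] b0 \<Delta>_nonneg \<open>K0 \<le> n\<close> N
  show False by (simp add: A_def)
qed

end

subsection \<open>The resistance between the particles\<close>

definition lerp_mover :: "(bool \<Rightarrow> nat \<Rightarrow> real) \<Rightarrow> lerp_state \<Rightarrow> bool" where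
  "lerp_mover E s \<longleftrightarrow> clock E True (snd (snd s) True) < clock E False (snd (snd s) False)"

definition lerp_prob :: "real \<Rightarrow> bool \<Rightarrow> lerp_state \<Rightarrow> real" where
  "lerp_prob \<Delta> i s = (case s of (x, W, c) \<Rightarrow> (W (x i) + \<Delta>) / (W (x i - 1) + W (x i) + \<Delta>))"

text \<open>The direction is an argument, so that both outcomes of a jump can be averaged without
  reference to a uniform variable.\<close>

definition lerp_move :: "bool \<Rightarrow> bool \<Rightarrow> lerp_state \<Rightarrow> lerp_state" where
  "lerp_move i right s = (case s of (x, W, c) \<Rightarrow>
     if right then (x(i := x i + 1), W(x i := W (x i) + 1), c(i := c i + 1))
     else (x(i := x i - 1), W(x i - 1 := W (x i - 1) + 1), c(i := c i + 1)))"

text \<open>The effective resistance between the two particles.\<close>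
definition lerp_potential :: "lerp_state \<Rightarrow> real" where
  "lerp_potential s = (\<Sum>v\<in>{fst s False..<fst s True}. 1 / fst (snd s) v)"

definition lerp_drift :: "real \<Rightarrow> bool \<Rightarrow> lerp_state \<Rightarrow> real" where
  "lerp_drift \<Delta> i s = (case s of (x, W, c) \<Rightarrow>
     (1 - \<Delta>) / ((W (if i then x i else x i - 1) + 1) * (W (x i - 1) + W (x i) + \<Delta>)))"

definition lerp_apart :: "lerp_state \<Rightarrow> bool" where
  "lerp_apart s \<longleftrightarrow> fst s False < fst s True"

lemma lerp_chain_Suc:
  "lerp_chain \<Delta> a l0 r0 E U (Suc k) =
    (let s = lerp_chain \<Delta> a l0 r0 E U k; i = lerp_mover E s
     in lerp_move i (U i (snd (snd s) i) < lerp_prob \<Delta> i s) s)"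
  by (simp add: Let_def lerp_mover_def lerp_prob_def lerp_move_def split: prod.split)

declare lerp_chain.simps(2) [simp del]

section \<open>Weights, jump counters and locality of the chain\<close>

lemma lerp_weight_ge: "0 < a \<Longrightarrow> a \<le> fst (snd (lerp_chain \<Delta> a l0 r0 E U k)) v"
proof (induction k arbitrary: v)
  case (Suc k)
  obtain x W c where s: "lerp_chain \<Delta> a l0 r0 E U k = (x, W, c)" by (metis prod.exhaust)
  have "a \<le> W v" for v using Suc s by (metis fst_conv snd_conv)
  thus ?case unfolding lerp_chain_Suc s by (auto simp: Let_def lerp_move_def add_increasing2)
qed simp

lemma lerp_count_move [simp]: "snd (snd (lerp_move i rt s)) = (snd (snd s))(i := snd (snd s) i + 1)"
  by (auto simp: lerp_move_def split: prod.split)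

text \<open>Which particle jumps next is decided by the exponential clocks alone.\<close>
lemma lerp_count_cong:
  "snd (snd (lerp_chain \<Delta> a l0 r0 E U k)) = snd (snd (lerp_chain \<Delta> a l0 r0 E U' k))"
  by (induction k) (simp_all add: lerp_chain_Suc Let_def lerp_mover_def)

lemma lerp_count_le: "snd (snd (lerp_chain \<Delta> a l0 r0 E U k)) i \<le> k"
proof (induction k)
  case (Suc k) thus ?case by (auto simp: lerp_chain_Suc Let_def)
qed simp

lemma lerp_count_Suc_ge:
  "snd (snd (lerp_chain \<Delta> a l0 r0 E U k)) i \<le> snd (snd (lerp_chain \<Delta> a l0 r0 E U (Suc k))) i"
  by (simp add: lerp_chain_Suc Let_def)

text \<open>A particle with \<open>n\<close> jumps has read exactly its first \<open>n\<close>
  uniform variables, so the state does not depend on the one to be read next.\<close>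

lemma lerp_chain_cong:
  assumes "\<And>i m. m < snd (snd (lerp_chain \<Delta> a l0 r0 E U k)) i \<Longrightarrow> U i m = U' i m"
  shows "lerp_chain \<Delta> a l0 r0 E U k = lerp_chain \<Delta> a l0 r0 E U' k"
  using assms
proof (induction k)
  case (Suc k)
  define s where "s = lerp_chain \<Delta> a l0 r0 E U k"
  have s': "lerp_chain \<Delta> a l0 r0 E U' k = s"
    unfolding s_def using Suc.prems lerp_count_Suc_ge by (intro Suc.IH[symmetric]) (meson less_le_trans)
  define i where "i = lerp_mover E s"
  have "U i (snd (snd s) i) = U' i (snd (snd s) i)"
    by (rule Suc.prems) (simp add: lerp_chain_Suc Let_def s_def i_def)
  thus ?case by (simp add: lerp_chain_Suc s' s_def[symmetric] i_def[symmetric] Let_def)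
qed simp

lemma lerp_prob_bounds:
  assumes "\<And>v. 0 < fst (snd s) v" "0 \<le> \<Delta>"
  shows "0 \<le> lerp_prob \<Delta> i s" "lerp_prob \<Delta> i s \<le> 1"
proof -
  obtain x W c where s: "s = (x, W, c)" by (metis prod.exhaust)
  have "0 < W v" for v using assms(1)[of v] s by simp
  from this[of "x i"] this[of "x i - 1"] assms(2)
  show "0 \<le> lerp_prob \<Delta> i s" "lerp_prob \<Delta> i s \<le> 1"
    unfolding s lerp_prob_def by (auto intro!: divide_nonneg_pos simp: divide_le_eq)
qed

lemma lerp_potential_nonneg: "(\<And>v. 0 < fst (snd s) v) \<Longrightarrow> 0 \<le> lerp_potential s"
  unfolding lerp_potential_def by (intro sum_nonneg) (simp add: less_imp_le)

lemma lerp_drift_nonneg: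
  assumes "\<And>v. 0 < fst (snd s) v" "0 \<le> \<Delta>" "\<Delta> < 1"
  shows "0 \<le> lerp_drift \<Delta> i s"
proof -
  obtain x W c where s: "s = (x, W, c)" by (metis prod.exhaust)
  have W: "0 \<le> W v" for v using assms(1)[of v] s by (simp add: less_imp_le)
  show ?thesis unfolding s lerp_drift_def using assms(2,3) W by (auto intro!: divide_nonneg_nonneg mult_nonneg_nonneg add_nonneg_nonneg)
qed

text \<open>With weights \<open>q\<close> below and \<open>p\<close> above the moving particle and
  \<open>Z = q + p + \<Delta>\<close>, the right particle changes the resistance in mean by
  \<open>((p + \<Delta>) / (p + 1) - 1) / Z\<close>, which the drift cancels exactly. For the left
  particle \<open>\<Delta>\<close> favours the inward jump, which leaves a surplus.\<close>

lemma lerp_potential_supermartingale: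
  assumes pos: "\<And>v. 0 < fst (snd s) v" and \<Delta>: "0 \<le> \<Delta>" "\<Delta> < 1" and ap: "lerp_apart s"
  shows "lerp_prob \<Delta> i s * lerp_potential (lerp_move i True s) +
      (1 - lerp_prob \<Delta> i s) * lerp_potential (lerp_move i False s) + lerp_drift \<Delta> i s
    \<le> lerp_potential s"
proof -
  obtain x W c where s: "s = (x, W, c)" by (metis prod.exhaust)
  have W: "0 < W v" for v using pos[of v] s by simp
  have lt: "x False < x True" using ap s by (simp add: lerp_apart_def)
  \<comment> \<open>The crossed edge enters the range of summation at an outward jump and leaves it
    at an inward one; the other summands keep their values.\<close>
  have sum_upd: "(\<Sum>v\<in>A. 1 / (W(u := z)) v) = (\<Sum>v\<in>A. 1 / W v)" if "u \<notin> A" for A :: "int set" and u z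
    using that by (intro sum.cong) auto
  define \<Phi> where "\<Phi> = (\<Sum>v\<in>{x False..<x True}. 1 / W v)"
  have \<Phi>: "lerp_potential s = \<Phi>" by (simp add: s lerp_potential_def \<Phi>_def)
  show ?thesis
  proof (cases i)
    case True
    define p q where "p = W (x True)" and "q = W (x True - 1)"
    have pq: "0 < p" "0 < q" using W by (auto simp: p_def q_def)
    have "{x False..<x True + 1} = insert (x True) {x False..<x True}" using lt by auto
    hence r: "lerp_potential (lerp_move i True s) = \<Phi> + 1 / (p + 1)"
      using True by (simp add: s lerp_potential_def lerp_move_def sum_upd \<Phi>_def p_def)
    have "{x False..<x True} = insert (x True - 1) {x False..<x True - 1}" using lt by auto
    hence l: "lerp_potential (lerp_move i False s) = \<Phi> - 1 / q"
      using True by (simp add: s lerp_potential_def lerp_move_def sum_upd \<Phi>_def q_def)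
    have P: "lerp_prob \<Delta> i s = (p + \<Delta>) / (q + p + \<Delta>)"
      and D: "lerp_drift \<Delta> i s = (1 - \<Delta>) / ((p + 1) * (q + p + \<Delta>))"
      using True by (auto simp: lerp_prob_def lerp_drift_def s p_def q_def)
    define Z where "Z = q + p + \<Delta>"
    have Z: "0 < Z" using pq \<Delta> by (simp add: Z_def)
    have P': "1 - (p + \<Delta>) / Z = q / Z" using Z by (simp add: field_simps) (simp add: Z_def)
    have "(p + \<Delta>) / Z * (\<Phi> + 1 / (p + 1)) + q / Z * (\<Phi> - 1 / q) + (1 - \<Delta>) / ((p + 1) * Z)
        = \<Phi> * ((p + \<Delta>) / Z + q / Z) + ((p + \<Delta>) / (p + 1) - 1 + (1 - \<Delta>) / (p + 1)) / Z"
      using pq Z by (simp add: divide_simps) (simp add: algebra_simps)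
    also have "(p + \<Delta>) / (p + 1) - 1 + (1 - \<Delta>) / (p + 1) = 0" using pq by (simp add: divide_simps)
    also have "(p + \<Delta>) / Z + q / Z = 1" using P' by simp
    finally show ?thesis unfolding r l P D \<Phi> Z_def[symmetric] P' by simp
  next
    case False
    define p q where "p = W (x False)" and "q = W (x False - 1)"
    have pq: "0 < p" "0 < q" using W by (auto simp: p_def q_def)
    have "{x False..<x True} = insert (x False) {x False + 1..<x True}" using lt by auto
    hence r: "lerp_potential (lerp_move i True s) = \<Phi> - 1 / p"
      using False by (simp add: s lerp_potential_def lerp_move_def sum_upd \<Phi>_def p_def)
    have "{x False - 1..<x True} = insert (x False - 1) {x False..<x True}" using lt by auto
    hence l: "lerp_potential (lerp_move i False s) = \<Phi> + 1 / (q + 1)"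
      using False by (simp add: s lerp_potential_def lerp_move_def sum_upd \<Phi>_def q_def)
    have P: "lerp_prob \<Delta> i s = (p + \<Delta>) / (q + p + \<Delta>)"
      and D: "lerp_drift \<Delta> i s = (1 - \<Delta>) / ((q + 1) * (q + p + \<Delta>))"
      using False by (auto simp: lerp_prob_def lerp_drift_def s p_def q_def)
    define Z where "Z = q + p + \<Delta>"
    have Z: "0 < Z" using pq \<Delta> by (simp add: Z_def)
    have P': "1 - (p + \<Delta>) / Z = q / Z" using Z by (simp add: field_simps) (simp add: Z_def)
    have "(p + \<Delta>) / Z * (\<Phi> - 1 / p) + q / Z * (\<Phi> + 1 / (q + 1)) + (1 - \<Delta>) / ((q + 1) * Z)
        = \<Phi> * ((p + \<Delta>) / Z + q / Z) - \<Delta> * (1 / p + 1 / (q + 1)) / Z"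
      using pq Z by (simp add: divide_simps) (simp add: algebra_simps)
    also have "(p + \<Delta>) / Z + q / Z = 1" using P' by simp
    also have "\<Phi> * 1 - \<Delta> * (1 / p + 1 / (q + 1)) / Z \<le> \<Phi>"
      using pq Z \<Delta> by simp
    finally show ?thesis unfolding r l P D \<Phi> Z_def[symmetric] P' by simp
  qed
qed

text \<open>Seen from the left particle, the line is reflected by \<open>v \<mapsto> -v\<close>, which maps the edge above
  \<open>v\<close> to the edge above \<open>-v - 1\<close>.\<close>
lemma lerp_drift_not_summable:
  fixes E U :: "bool \<Rightarrow> nat \<Rightarrow> real" and \<Delta> a :: real and l0 r0 :: int
  defines "S \<equiv> lerp_chain \<Delta> a l0 r0 E U"
  assumes \<Delta>: "0 \<le> \<Delta>" "\<Delta> < 1" and a: "0 < a" and apart: "\<And>k. lerp_apart (S k)"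
  shows "\<not> summable (\<lambda>k. lerp_drift \<Delta> (lerp_mover E (S k)) (S k))"
proof
  assume sm: "summable (\<lambda>k. lerp_drift \<Delta> (lerp_mover E (S k)) (S k))"
  define x where "x k = fst (S k)" for k
  define W where "W k = fst (snd (S k))" for k
  define c where "c k = snd (snd (S k))" for k
  have S: "S k = (x k, W k, c k)" for k by (simp add: x_def W_def c_def)
  define i where "i k = lerp_mover E (S k)" for k
  have W0: "W k v > 0" for k v
    using lerp_weight_ge[OF a, of \<Delta> l0 r0 E U k v] a by (simp add: W_def S_def)
  have ap: "x k False < x k True" for k using apart[of k] by (simp add: lerp_apart_def x_def)
  have dn: "0 \<le> lerp_drift \<Delta> (lerp_mover E (S k)) (S k)" for k
    using W0 \<Delta> by (intro lerp_drift_nonneg) (auto simp: S)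
  have step: "\<exists>rt. S (Suc k) = lerp_move (i k) rt (S k)" for k
    unfolding S_def i_def lerp_chain_Suc Let_def by blast
  have step': "(x (Suc k) = (x k)(i k := x k (i k) + 1) \<and> W (Suc k) = (W k)(x k (i k) := W k (x k (i k)) + 1)) \<or>
     (x (Suc k) = (x k)(i k := x k (i k) - 1) \<and> W (Suc k) = (W k)(x k (i k) - 1 := W k (x k (i k) - 1) + 1))" for k
    using step[of k] unfolding S by (auto simp: lerp_move_def split: if_splits)
  interpret R: outward_particle "\<lambda>k. x k True" W i \<Delta> a "\<lambda>k. lerp_drift \<Delta> (i k) (S k)"
  proof
    fix k v
    show "i k \<Longrightarrow> (x (Suc k) True = x k True + 1 \<and> W (Suc k) = (W k)(x k True := W k (x k True) + 1)) \<or>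
      (x (Suc k) True = x k True - 1 \<and> W (Suc k) = (W k)(x k True - 1 := W k (x k True - 1) + 1))"
      using step'[of k] by auto
    \<comment> \<open>The particles are apart before and after the left jump, so the crossed edge
      ends at or below \<open>x k True - 1\<close>.\<close>
    show "\<not> i k \<Longrightarrow> x (Suc k) True = x k True \<and> (\<forall>v\<ge>x k True - 1. W (Suc k) v = W k v)"
      using step'[of k] ap[of k] ap[of "Suc k"] by auto
    show "W 0 v = a" by (simp add: W_def S_def)
    show "i k \<Longrightarrow> lerp_drift \<Delta> (i k) (S k) = (1 - \<Delta>) / ((W k (x k True) + 1) * (W k (x k True - 1) + W k (x k True) + \<Delta>))"
      by (simp add: lerp_drift_def S)
  qed (use \<Delta> W0 dn sm in \<open>auto simp: i_def\<close>)
  interpret L: outward_particle "\<lambda>k. - x k False" "\<lambda>k v. W k (- v - 1)" "\<lambda>k. \<not> i k" \<Delta> a "\<lambda>k. lerp_drift \<Delta> (i k) (S k)"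
  proof
    fix k v
    show "\<not> i k \<Longrightarrow> (- x (Suc k) False = - x k False + 1 \<and>
         (\<lambda>v. W (Suc k) (- v - 1)) = (\<lambda>v. W k (- v - 1))(- x k False := W k (- (- x k False) - 1) + 1)) \<or>
      (- x (Suc k) False = - x k False - 1 \<and>
         (\<lambda>v. W (Suc k) (- v - 1)) = (\<lambda>v. W k (- v - 1))(- x k False - 1 := W k (- (- x k False - 1) - 1) + 1))"
      using step'[of k] by (auto simp: fun_eq_iff)
    show "\<not> \<not> i k \<Longrightarrow> - x (Suc k) False = - x k False \<and> (\<forall>v\<ge>- x k False - 1. W (Suc k) (- v - 1) = W k (- v - 1))"
      using step'[of k] ap[of k] ap[of "Suc k"] by auto
    show "W 0 (- v - 1) = a" by (simp add: W_def S_def)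
    show "\<not> i k \<Longrightarrow> lerp_drift \<Delta> (i k) (S k) = (1 - \<Delta>) / ((W k (- (- x k False) - 1) + 1) *
       (W k (- (- x k False - 1) - 1) + W k (- (- x k False) - 1) + \<Delta>))"
      by (simp add: lerp_drift_def S add.commute)
  qed (use \<Delta> W0 dn sm in \<open>auto simp: i_def\<close>)
  obtain B where B: "\<And>k. x k True \<le> B" using R.bounded_above by blast
  obtain B' where B': "\<And>k. - x k False \<le> B'" using L.bounded_above by blast
  \<comment> \<open>On its inward side each particle is bounded by the outward bound of the
    other.\<close>
  have "finite {k. i k}"
  proof (rule R.finitely_many_jumps)
    show "- B' \<le> x k True" for k using B'[of k] ap[of k] by linarith
  qed
  moreover have "finite {k. \<not> i k}"
  proof (rule L.finitely_many_jumps)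
    show "- B \<le> - x k False" for k using B[of k] ap[of k] by linarith
  qed
  ultimately have "finite ({k. i k} \<union> {k. \<not> i k})" by simp
  moreover have "{k. i k} \<union> {k. \<not> i k} = UNIV" by auto
  ultimately show False by simp
qed

subsection \<open>Resampling one variable of an independent family\<close>

text \<open>By independence the joint law of \<open>Z j\<close> and the other variables is a
  product, so Fubini allows integrating out coordinate \<open>j\<close> alone.\<close>

lemma (in prob_space) nn_integral_resample:
  fixes Z :: "'i \<Rightarrow> 'a \<Rightarrow> real" and F :: "('i \<Rightarrow> real) \<Rightarrow> ennreal"
  assumes ind: "indep_vars (\<lambda>_. borel) Z UNIV"
    and F [measurable]: "F \<in> borel_measurable (PiM UNIV (\<lambda>_. borel))"
  shows "(\<integral>\<^sup>+\<omega>. F (\<lambda>i. Z i \<omega>) \<partial>M) = (\<integral>\<^sup>+\<omega>. \<integral>\<^sup>+u. F ((\<lambda>i. Z i \<omega>)(j := u)) \<partial>distr M borel (Z j) \<partial>M)"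
proof -
  define A where "A = UNIV - {j}"
  define X where "X \<omega> = restrict (\<lambda>i. Z i \<omega>) A" for \<omega>
  let ?S = "PiM A (\<lambda>_. borel :: real measure)"
  have Zm [measurable]: "Z i \<in> borel_measurable M" for i
    using ind by (auto simp: indep_vars_def)
  let ?T = "PiM {j} (\<lambda>_. borel :: real measure)"
  define Y where "Y \<omega> = restrict (\<lambda>i. Z i \<omega>) {j}" for \<omega>
  have "indep_var ?S X ?T Y"
    unfolding X_def Y_def by (rule indep_var_restrict[OF ind]) (auto simp: A_def)
  hence X [measurable]: "X \<in> measurable M ?S" and Y [measurable]: "Y \<in> measurable M ?T"
    and joint: "distr M ?S X \<Otimes>\<^sub>M distr M ?T Y = distr M (?S \<Otimes>\<^sub>M ?T) (\<lambda>\<omega>. (X \<omega>, Y \<omega>))"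
    by (auto simp: indep_var_distribution_eq)
  have "(\<lambda>p. (fst p)(j := snd p j)) \<in> measurable (?S \<Otimes>\<^sub>M ?T) (PiM UNIV (\<lambda>_. borel))"
    by (rule measurable_fun_upd[where J = A]) (auto simp: A_def intro!: measurable_compose[OF measurable_snd])
  hence G [measurable]: "(\<lambda>p. F ((fst p)(j := snd p j))) \<in> borel_measurable (?S \<Otimes>\<^sub>M ?T)"
    by (rule measurable_compose[OF _ F])
  interpret Y: prob_space "distr M ?T Y" by (rule prob_space_distr) simp
  \<comment> \<open>The update overwrites the default value that \<open>restrict\<close> puts at
    \<open>j\<close>.\<close>
  have X_upd: "(X \<omega>)(j := u) = (\<lambda>i. Z i \<omega>)(j := u)" for \<omega> u
    by (auto simp: X_def A_def fun_eq_iff)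
  have Yj: "Y \<omega> j = Z j \<omega>" for \<omega> by (simp add: Y_def)
  have upd: "(\<lambda>u. F ((\<lambda>i. Z i \<omega>)(j := u))) \<in> borel_measurable borel" for \<omega>
    by (rule measurable_compose[OF _ F], rule measurable_fun_upd[where J = UNIV]) (auto simp: space_PiM)
  have inner: "(\<integral>\<^sup>+y. F ((X \<omega>)(j := y j)) \<partial>distr M ?T Y) =
      (\<integral>\<^sup>+u. F ((\<lambda>i. Z i \<omega>)(j := u)) \<partial>distr M borel (Z j))" for \<omega>
  proof -
    have "(\<lambda>y. F ((X \<omega>)(j := y j))) \<in> borel_measurable ?T"
      unfolding X_upd by (rule measurable_compose[OF _ upd]) simp
    thus ?thesis by (simp add: nn_integral_distr upd X_upd Yj)
  qed
  have "(\<integral>\<^sup>+\<omega>. F (\<lambda>i. Z i \<omega>) \<partial>M) = (\<integral>\<^sup>+\<omega>. F ((X \<omega>)(j := Y \<omega> j)) \<partial>M)"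
    by (simp add: X_upd Yj fun_upd_idem)
  also have "\<dots> = (\<integral>\<^sup>+p. F ((fst p)(j := snd p j)) \<partial>distr M (?S \<Otimes>\<^sub>M ?T) (\<lambda>\<omega>. (X \<omega>, Y \<omega>)))"
    by (subst nn_integral_distr) auto
  also have "\<dots> = (\<integral>\<^sup>+x. \<integral>\<^sup>+y. F (x(j := y j)) \<partial>distr M ?T Y \<partial>distr M ?S X)"
    unfolding joint[symmetric] by (subst Y.nn_integral_fst[symmetric]) (auto cong: measurable_cong_sets)
  also have "\<dots> = (\<integral>\<^sup>+\<omega>. \<integral>\<^sup>+y. F ((X \<omega>)(j := y j)) \<partial>distr M ?T Y \<partial>M)"
  proof (rule nn_integral_distr[OF X])
    have "(\<lambda>p. F ((fst p)(j := snd p j))) \<in> borel_measurable (?S \<Otimes>\<^sub>M distr M ?T Y)"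
      using G by (simp cong: measurable_cong_sets)
    from Y.borel_measurable_nn_integral_fst[OF this]
    show "(\<lambda>x. \<integral>\<^sup>+y. F (x(j := y j)) \<partial>distr M ?T Y) \<in> borel_measurable (distr M ?S X)" by simp
  qed
  finally show ?thesis by (simp add: inner)
qed

lemma distr_borel_eq_density:
  assumes "distributed M lborel X f"
  shows "distr M borel X = density lborel f"
proof -
  have "distr M borel X = distr M lborel X" by (rule distr_cong) auto
  thus ?thesis using assms by (simp add: distributed_distr_eq_density)
qed

lemma nn_integral_uniform_threshold:
  assumes "0 \<le> p" "p \<le> 1"
  shows "(\<integral>\<^sup>+u. (if u < p then \<alpha> else \<beta>) \<partial>density lborel (indicator {0..1::real})) =
    ennreal p * \<alpha> + ennreal (1 - p) * \<beta>"
proof -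
  have "(\<integral>\<^sup>+u. (if u < p then \<alpha> else \<beta>) \<partial>density lborel (indicator {0..1::real})) =
      (\<integral>\<^sup>+u. \<alpha> * indicator {0..<p} u + \<beta> * indicator {p..1} u \<partial>lborel)"
    using assms by (subst nn_integral_density) (auto intro!: nn_integral_cong simp: indicator_def)
  also have "\<dots> = \<alpha> * ennreal p + \<beta> * ennreal (1 - p)"
    using assms by (simp add: nn_integral_add nn_integral_cmult_indicator)
  finally show ?thesis by (simp add: mult.commute)
qed

text \<open>A tie forces the last waiting time of the right particle to equal \<open>G\<close>,
  which is computed from other variables only; the exponential law has no atoms.\<close>

lemma (in prob_space) AE_clocks_distinct:
  fixes Z :: "bool \<times> bool \<times> nat \<Rightarrow> 'a \<Rightarrow> real"
  assumes ind: "indep_vars (\<lambda>_. borel) Z UNIV"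
    and "\<And>i k. distributed M lborel (Z (True, i, k)) (exponential_density 1)"
  shows "AE \<omega> in M. clock (\<lambda>i k. Z (True, i, k) \<omega>) True m \<noteq> clock (\<lambda>i k. Z (True, i, k) \<omega>) False n"
proof -
  have [measurable]: "Z i \<in> borel_measurable M" for i
    using ind by (simp add: indep_vars_def del: split_paired_All)
  define G where "G z = (\<Sum>j\<le>n. z (True, False, j)) - (\<Sum>j<m. z (True, True, j))" for z :: "bool \<times> bool \<times> nat \<Rightarrow> real"
  define F where "F z = (indicator {0} (z (True, True, m) - G z) :: ennreal)" for z
  have tie: "F (\<lambda>i. Z i \<omega>) = 0 \<longleftrightarrow>
      clock (\<lambda>i k. Z (True, i, k) \<omega>) True m \<noteq> clock (\<lambda>i k. Z (True, i, k) \<omega>) False n" for \<omega>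
    by (auto simp: F_def G_def clock_def lessThan_Suc_atMost[symmetric] indicator_def)
  have Fm [measurable]: "F \<in> borel_measurable (PiM UNIV (\<lambda>_. borel))"
    unfolding F_def G_def by measurable
  have inner: "(\<integral>\<^sup>+u. F (z((True, True, m) := u)) \<partial>distr M borel (Z (True, True, m))) = 0" for z
  proof -
    have "F (z((True, True, m) := u)) = indicator {G z} u" for u
      by (auto simp: F_def G_def indicator_def)
    moreover have "emeasure (density lborel (\<lambda>x. ennreal (exponential_density 1 x))) {G z} = 0"
      by (subst emeasure_density) (auto simp: nn_integral_0_iff_AE intro!: AE_mp[OF AE_lborel_singleton[of "G z"]])
    ultimately show ?thesis by (simp add: distr_borel_eq_density[OF assms(2)])
  qed
  have "(\<integral>\<^sup>+\<omega>. F (\<lambda>i. Z i \<omega>) \<partial>M) = 0"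
    by (subst nn_integral_resample[OF ind Fm, where j = "(True, True, m)"]) (simp add: inner)
  moreover have "(\<lambda>\<omega>. F (\<lambda>i. Z i \<omega>)) \<in> borel_measurable M"
    unfolding F_def G_def by measurable
  ultimately have "AE \<omega> in M. F (\<lambda>i. Z i \<omega>) = 0" by (simp add: nn_integral_0_iff_AE)
  thus ?thesis by (simp add: tie)
qed

text \<open>Transfers a meeting of the jump chain to continuous time: without ties the jump times
  increase strictly, so counting those up to a jump time recovers the index of the chain.\<close>

lemma lerp_meet_time_finite:
  fixes E U :: "bool \<Rightarrow> nat \<Rightarrow> real" and \<Delta> a :: real and l0 r0 :: int
  defines "S \<equiv> lerp_chain \<Delta> a l0 r0 E U"
  assumes pos: "\<And>i k. 0 < E i k" and ties: "\<And>m n. clock E True m \<noteq> clock E False n"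
    and "l0 < r0" and ex: "\<exists>k. \<not> lerp_apart (S k)"
  shows "lerp_meet_time \<Delta> a l0 r0 E U < \<infinity>"
proof -
  define m where "m = (LEAST k. \<not> lerp_apart (S k))"
  have m: "\<not> lerp_apart (S m)" unfolding m_def by (rule LeastI_ex[OF ex])
  have "lerp_apart (S 0)" using \<open>l0 < r0\<close> by (simp add: lerp_apart_def S_def)
  with m obtain n where n: "m = Suc n" by (cases m) auto
  have apart_n: "lerp_apart (S n)"
    using not_less_Least[of n "\<lambda>k. \<not> lerp_apart (S k)"] n by (simp add: m_def)
  obtain i rt where Sm: "S (Suc n) = lerp_move i rt (S n)"
    unfolding S_def lerp_chain_Suc Let_def by blast
  \<comment> \<open>A unit step of one particle cannot carry it past the other.\<close>
  have meet: "fst (S (Suc n)) False = fst (S (Suc n)) True"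
    using apart_n m unfolding n Sm
    by (cases i) (auto simp: lerp_apart_def lerp_move_def split: prod.splits if_splits)
  have E_less: "clock E i k < clock E i (Suc k)" for i k using pos by (simp add: clock_def)
  let ?T = "lerp_jumptime \<Delta> a l0 r0 E U"
  have T: "?T k = min (clock E False (snd (snd (S k)) False)) (clock E True (snd (snd (S k)) True))" for k
    by (simp add: lerp_jumptime_def S_def split: prod.split)
  have "?T k < ?T (Suc k)" for k
  proof -
    \<comment> \<open>The clock that rang advances to its next ring; the other pending ring is
      strictly later because ties are excluded.\<close>
    have "snd (snd (S (Suc k))) = (snd (snd (S k)))(lerp_mover E (S k) := snd (snd (S k)) (lerp_mover E (S k)) + 1)"
      by (simp add: S_def lerp_chain_Suc Let_def)
    thus ?thesis
      using ties[of "snd (snd (S k)) True" "snd (snd (S k)) False"] E_less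
      unfolding T by (cases "lerp_mover E (S k)") (auto simp: lerp_mover_def min_def not_less)
  qed
  hence sm: "strict_mono ?T" by (simp add: strict_mono_Suc_iff)
  \<comment> \<open>These are \<open>n + 1\<close> indices, so at time \<open>?T n\<close> the state
    is the one after that jump.\<close>
  have "{k. ?T k \<le> ?T n} = {..n}" using strict_mono_less_eq[OF sm] by auto
  hence "lerp_pos \<Delta> a l0 r0 E U (?T n) i = fst (S (Suc n)) i" for i
    by (simp add: lerp_pos_def S_def)
  moreover have "0 \<le> ?T n"
    unfolding T clock_def using pos by (simp add: sum_nonneg less_imp_le)
  ultimately have "lerp_meet_time \<Delta> a l0 r0 E U \<le> ereal (?T n)"
    unfolding lerp_meet_time_def using meet by (intro INF_lower) auto
  thus ?thesis by (rule le_less_trans) simp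
qed

subsection \<open>Almost sure meeting\<close>

text \<open>All driving variables form one point of a product space: the first flag is
  \<open>True\<close> for waiting times and \<open>False\<close> for uniform variables, followed by
  particle and index.\<close>

abbreviation driver_space :: "(bool \<times> bool \<times> nat \<Rightarrow> real) measure" where
  "driver_space \<equiv> PiM UNIV (\<lambda>_. borel)"

abbreviation driver_E :: "(bool \<times> bool \<times> nat \<Rightarrow> real) \<Rightarrow> bool \<Rightarrow> nat \<Rightarrow> real" where
  "driver_E z \<equiv> \<lambda>i k. z (True, i, k)"

locale two_point_lerp =
  fixes \<Delta> a :: real and l0 r0 :: int
  assumes \<Delta>_nonneg: "0 \<le> \<Delta>" and \<Delta>_less_1: "\<Delta> < 1" and a_pos: "0 < a"
begin

definition chain :: "(bool \<times> bool \<times> nat \<Rightarrow> real) \<Rightarrow> nat \<Rightarrow> lerp_state" where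
  "chain z = lerp_chain \<Delta> a l0 r0 (driver_E z) (\<lambda>i k. z (False, i, k))"

definition mover :: "(bool \<times> bool \<times> nat \<Rightarrow> real) \<Rightarrow> nat \<Rightarrow> bool" where
  "mover z k = lerp_mover (driver_E z) (chain z k)"

definition unmet :: "(bool \<times> bool \<times> nat \<Rightarrow> real) \<Rightarrow> nat \<Rightarrow> bool" where
  "unmet z k \<longleftrightarrow> (\<forall>j\<le>k. lerp_apart (chain z j))"

abbreviation count :: "(bool \<times> bool \<times> nat \<Rightarrow> real) \<Rightarrow> nat \<Rightarrow> bool \<Rightarrow> nat" where
  "count z k i \<equiv> snd (snd (chain z k)) i"

lemma chain_Suc:
  "chain z (Suc k) = lerp_move (mover z k)
     (z (False, mover z k, count z k (mover z k)) < lerp_prob \<Delta> (mover z k) (chain z k)) (chain z k)"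
  by (simp add: chain_def mover_def lerp_chain_Suc Let_def)

lemma weight_pos: "0 < fst (snd (chain z k)) v"
  using lerp_weight_ge[OF a_pos] a_pos unfolding chain_def by (meson less_le_trans)

section \<open>Measurability of the chain\<close>

lemma clock_measurable: "(\<lambda>z. clock (driver_E z) i n) \<in> borel_measurable driver_space"
  unfolding clock_def by measurable

lemma lerp_mover_measurable: "Measurable.pred driver_space (\<lambda>z. lerp_mover (driver_E z) s)"
  unfolding lerp_mover_def using clock_measurable by measurable

text \<open>After \<open>k\<close> steps only countably many states are possible, so every function of the state is
  measurable.\<close>
lemma chain_countable: "\<exists>C. countable C \<and> (\<lambda>z. chain z k) \<in> measurable driver_space (count_space C)"
proof (induction k)
  case 0
  have "(\<lambda>z. chain z 0) \<in> measurable driver_space (count_space {chain (\<lambda>_. 0) 0})"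
    by (simp add: chain_def)
  thus ?case by (intro exI[of _ "{chain (\<lambda>_. 0) 0}"]) simp
next
  case (Suc k)
  then obtain C where C: "countable C" "(\<lambda>z. chain z k) \<in> measurable driver_space (count_space C)" by blast
  define C' where "C' = (\<Union>s\<in>C. \<Union>i rt. {lerp_move i rt s})"
  define f where "f s z = (let i = lerp_mover (driver_E z) s in
      lerp_move i (z (False, i, snd (snd s) i) < lerp_prob \<Delta> i s) s)" for s and z :: "bool \<times> bool \<times> nat \<Rightarrow> real"
  have f: "f s \<in> measurable driver_space (count_space C')" if "s \<in> C" for s
  proof -
    have mem: "lerp_move i rt s \<in> C'" for i rt using that by (auto simp: C'_def)
    have "f s = (\<lambda>z. if lerp_mover (driver_E z) s
        then if z (False, True, snd (snd s) True) < lerp_prob \<Delta> True s then lerp_move True True s else lerp_move True False s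
        else if z (False, False, snd (snd s) False) < lerp_prob \<Delta> False s then lerp_move False True s else lerp_move False False s)"
      by (auto simp: f_def Let_def fun_eq_iff)
    also have "\<dots> \<in> measurable driver_space (count_space C')"
    proof -
      have "{z \<in> space driver_space. z j < r} \<in> sets driver_space" for j and r :: real by measurable
      moreover have "{z \<in> space driver_space. lerp_mover (driver_E z) s} \<in> sets driver_space"
        using lerp_mover_measurable[of s] by (rule predE)
      ultimately show ?thesis by (intro measurable_If measurable_const) (simp_all add: mem)
    qed
    finally show ?thesis .
  qed
  have "(\<lambda>z. f (chain z k) z) \<in> measurable driver_space (count_space C')"
    by (rule measurable_compose_countable'[OF f C(2,1)])
  moreover have "f (chain z k) z = chain z (Suc k)" for z
    by (simp add: f_def chain_Suc mover_def Let_def)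
  moreover have "countable C'" using C(1) by (simp add: C'_def)
  ultimately show ?case by auto
qed

lemma chain_measurable:
  assumes "\<And>s. (\<lambda>z. f s z) \<in> measurable driver_space N"
  shows "(\<lambda>z. f (chain z k) z) \<in> measurable driver_space N"
proof -
  obtain C where C: "countable C" "(\<lambda>z. chain z k) \<in> measurable driver_space (count_space C)"
    using chain_countable by blast
  show ?thesis by (rule measurable_compose_countable'[OF assms C(2,1)])
qed

lemma mover_measurable [measurable]: "Measurable.pred driver_space (\<lambda>z. mover z k)"
  unfolding mover_def
  by (rule chain_measurable[where f = "\<lambda>s z. lerp_mover (driver_E z) s"]) (rule lerp_mover_measurable)

lemma count_measurable [measurable]: "Measurable.pred driver_space (\<lambda>z. count z k i = n)"
  by (rule chain_measurable[where f = "\<lambda>s z. snd (snd s) i = n"]) simp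

lemma unmet_measurable [measurable]: "Measurable.pred driver_space (\<lambda>z. unmet z k)"
proof -
  have "Measurable.pred driver_space (\<lambda>z. lerp_apart (chain z j))" for j
    by (rule chain_measurable[where f = "\<lambda>s z. lerp_apart s"]) simp
  thus ?thesis unfolding unmet_def by measurable
qed

lemma chain_function_measurable [measurable]:
  "(\<lambda>z. g (chain z k) :: ennreal) \<in> borel_measurable driver_space"
  by (rule chain_measurable[where f = "\<lambda>s z. g s"]) simp

text \<open>Setting the potential to 0 from the first meeting on avoids any analysis of the later
  motion.\<close>

definition pot :: "nat \<Rightarrow> (bool \<times> bool \<times> nat \<Rightarrow> real) \<Rightarrow> ennreal" where
  "pot k z = (if unmet z k then ennreal (lerp_potential (chain z k)) else 0)"

definition drift :: "nat \<Rightarrow> (bool \<times> bool \<times> nat \<Rightarrow> real) \<Rightarrow> ennreal" where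
  "drift k z = (if unmet z k then ennreal (lerp_drift \<Delta> (mover z k) (chain z k)) else 0)"

lemma pot_measurable [measurable]: "pot k \<in> borel_measurable driver_space"
  unfolding pot_def by measurable

lemma drift_measurable [measurable]: "drift k \<in> borel_measurable driver_space"
proof -
  have "drift k = (\<lambda>z. if unmet z k then if mover z k then ennreal (lerp_drift \<Delta> True (chain z k))
      else ennreal (lerp_drift \<Delta> False (chain z k)) else 0)"
    by (auto simp: drift_def fun_eq_iff)
  also have "\<dots> \<in> borel_measurable driver_space" by measurable
  finally show ?thesis .
qed

text \<open>Which uniform variable step \<open>k\<close> reads is random; on this event it is the
  fixed coordinate \<open>(False, i, n)\<close>, which can then be resampled.\<close>

definition moves_nth :: "nat \<Rightarrow> bool \<Rightarrow> nat \<Rightarrow> (bool \<times> bool \<times> nat \<Rightarrow> real) \<Rightarrow> bool" where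
  "moves_nth k i n z \<longleftrightarrow> mover z k = i \<and> count z k i = n"

lemma moves_nth_measurable [measurable]: "Measurable.pred driver_space (moves_nth k i n)"
  unfolding moves_nth_def by (cases i) simp_all

definition on_move ::
    "nat \<Rightarrow> bool \<times> nat \<Rightarrow> ((bool \<times> bool \<times> nat \<Rightarrow> real) \<Rightarrow> ennreal) \<Rightarrow> (bool \<times> bool \<times> nat \<Rightarrow> real) \<Rightarrow> ennreal" where
  "on_move k p f z = (if moves_nth k (fst p) (snd p) z then f z else 0)"

lemma on_move_measurable [measurable]:
  assumes [measurable]: "f \<in> borel_measurable driver_space"
  shows "on_move k p f \<in> borel_measurable driver_space"
  unfolding on_move_def by measurable

section \<open>Changing a single uniform variable\<close>

lemma count_mono: "j \<le> k \<Longrightarrow> count z j i \<le> count z k i"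
  by (rule lift_Suc_mono_le[of "\<lambda>k. count z k i"]) (auto simp: chain_def lerp_count_Suc_ge)

lemma count_upd: "count (z((False, i, n) := u)) k = count z k"
proof -
  have "driver_E (z((False, i, n) := u)) = driver_E z" by auto
  thus ?thesis unfolding chain_def by (metis lerp_count_cong)
qed

lemma mover_upd: "mover (z((False, i, n) := u)) k = mover z k"
  by (simp add: mover_def lerp_mover_def count_upd)

lemma moves_nth_upd: "moves_nth k i n (z((False, i, n) := u)) = moves_nth k i n z"
  by (simp add: moves_nth_def count_upd mover_upd)

text \<open>On the event, coordinate \<open>(False, i, n)\<close> is first read by the jump out of
  state \<open>k\<close>, so no state up to \<open>k\<close> has used it.\<close>

lemma chain_upd:
  assumes "moves_nth k i n z" "j \<le> k"
  shows "chain (z((False, i, n) := u)) j = chain z j"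
proof -
  have "count z j i \<le> n" using assms count_mono[of j k z i] by (simp add: moves_nth_def)
  hence "lerp_chain \<Delta> a l0 r0 (driver_E z) (\<lambda>i k. z (False, i, k)) j =
      lerp_chain \<Delta> a l0 r0 (driver_E z) (\<lambda>i' k. (z((False, i, n) := u)) (False, i', k)) j"
    by (intro lerp_chain_cong) (auto simp: chain_def)
  thus ?thesis by (simp add: chain_def)
qed

text \<open>Only an inequality, because the left side drops to 0 if the jump makes the particles
  meet.\<close>

lemma pot_Suc_upd_le:
  assumes "moves_nth k i n z"
  shows "pot (Suc k) (z((False, i, n) := u)) \<le>
    (if unmet z k then ennreal (lerp_potential (lerp_move i (u < lerp_prob \<Delta> i (chain z k)) (chain z k))) else 0)"
proof -
  let ?z = "z((False, i, n) := u)"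
  have m: "mover ?z k = i" "count ?z k i = n" using assms by (auto simp: moves_nth_def mover_upd count_upd)
  have "chain ?z (Suc k) = lerp_move i (u < lerp_prob \<Delta> i (chain z k)) (chain z k)"
    unfolding chain_Suc m using chain_upd[OF assms order_refl] by simp
  moreover have "unmet ?z (Suc k) \<Longrightarrow> unmet z k"
    using chain_upd[OF assms] unfolding unmet_def by (metis le_Suc_eq)
  ultimately show ?thesis by (auto simp: pot_def)
qed

end

section \<open>The supermartingale inequality in mean\<close>

locale two_point_lerp_prob = prob_space M + two_point_lerp \<Delta> a l0 r0
  for M :: "'w measure" and \<Delta> a l0 r0 +
  fixes Z :: "bool \<times> bool \<times> nat \<Rightarrow> 'w \<Rightarrow> real"
  assumes indep: "indep_vars (\<lambda>_. borel) Z UNIV"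
    and uniform: "\<And>i k. distributed M lborel (Z (False, i, k)) (indicator {0..1})"
begin

abbreviation driver :: "'w \<Rightarrow> bool \<times> bool \<times> nat \<Rightarrow> real" where
  "driver \<omega> \<equiv> (\<lambda>j. Z j \<omega>)"

lemma driver_measurable [measurable]: "driver \<in> measurable M driver_space"
  using indep by (intro measurable_PiM_single') (auto simp: indep_vars_def simp del: split_paired_All)

text \<open>Takes the place of conditioning on the past: resampling the uniform variable read at
  step \<open>k\<close> leaves the state and the event unchanged, so its inner integral reduces the
  claim to \<open>lerp_potential_supermartingale\<close>.\<close>

lemma pot_decrease_on:
 "(\<integral>\<^sup>+\<omega>. on_move k (i, n) (pot (Suc k)) (driver \<omega>) \<partial>M) + (\<integral>\<^sup>+\<omega>. on_move k (i, n) (drift k) (driver \<omega>) \<partial>M)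
    \<le> (\<integral>\<^sup>+\<omega>. on_move k (i, n) (pot k) (driver \<omega>) \<partial>M)"
proof -
  \<comment> \<open>The average over the direction of the next jump, from the state at time
    \<open>k\<close>.\<close>
  define P where "P z = ennreal (lerp_prob \<Delta> i (chain z k)) * ennreal (lerp_potential (lerp_move i True (chain z k)))
      + ennreal (1 - lerp_prob \<Delta> i (chain z k)) * ennreal (lerp_potential (lerp_move i False (chain z k)))" for z
  define B where "B z = (if moves_nth k i n z \<and> unmet z k then P z else 0)" for z
  have [measurable]: "P \<in> borel_measurable driver_space" unfolding P_def by measurable
  have [measurable]: "B \<in> borel_measurable driver_space" unfolding B_def by measurable
  have "(\<integral>\<^sup>+u. on_move k (i, n) (pot (Suc k)) (z((False, i, n) := u)) \<partial>distr M borel (Z (False, i, n))) \<le> B z" for z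
  proof (cases "moves_nth k i n z \<and> unmet z k")
    case True
    have "(\<integral>\<^sup>+u. on_move k (i, n) (pot (Suc k)) (z((False, i, n) := u)) \<partial>distr M borel (Z (False, i, n))) \<le>
       (\<integral>\<^sup>+u. (if u < lerp_prob \<Delta> i (chain z k) then ennreal (lerp_potential (lerp_move i True (chain z k)))
          else ennreal (lerp_potential (lerp_move i False (chain z k)))) \<partial>distr M borel (Z (False, i, n)))"
    proof (rule nn_integral_mono)
      fix u
      show "on_move k (i, n) (pot (Suc k)) (z((False, i, n) := u)) \<le>
          (if u < lerp_prob \<Delta> i (chain z k) then ennreal (lerp_potential (lerp_move i True (chain z k)))
           else ennreal (lerp_potential (lerp_move i False (chain z k))))"
        using True pot_Suc_upd_le[of k i n z u]
        by (cases "u < lerp_prob \<Delta> i (chain z k)") (auto simp: on_move_def moves_nth_upd)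
    qed
    also have "\<dots> = B z"
      using True lerp_prob_bounds[OF weight_pos \<Delta>_nonneg]
      by (simp add: distr_borel_eq_density[OF uniform] nn_integral_uniform_threshold B_def P_def)
    finally show ?thesis .
  next
    case False
    have "on_move k (i, n) (pot (Suc k)) (z((False, i, n) := u)) = 0" for u
      using False pot_Suc_upd_le[of k i n z u] by (auto simp: on_move_def moves_nth_upd)
    thus ?thesis by simp
  qed
  hence "(\<integral>\<^sup>+\<omega>. on_move k (i, n) (pot (Suc k)) (driver \<omega>) \<partial>M) \<le> (\<integral>\<^sup>+\<omega>. B (driver \<omega>) \<partial>M)"
    by (subst nn_integral_resample[OF indep on_move_measurable[OF pot_measurable], where j = "(False, i, n)"]) (intro nn_integral_mono)
  hence "(\<integral>\<^sup>+\<omega>. on_move k (i, n) (pot (Suc k)) (driver \<omega>) \<partial>M) + (\<integral>\<^sup>+\<omega>. on_move k (i, n) (drift k) (driver \<omega>) \<partial>M)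
      \<le> (\<integral>\<^sup>+\<omega>. B (driver \<omega>) \<partial>M) + (\<integral>\<^sup>+\<omega>. on_move k (i, n) (drift k) (driver \<omega>) \<partial>M)"
    by (rule add_right_mono)
  also have "\<dots> = (\<integral>\<^sup>+\<omega>. B (driver \<omega>) + on_move k (i, n) (drift k) (driver \<omega>) \<partial>M)"
    by (rule nn_integral_add[symmetric]) measurable
  also have "\<dots> \<le> (\<integral>\<^sup>+\<omega>. on_move k (i, n) (pot k) (driver \<omega>) \<partial>M)"
  proof (rule nn_integral_mono)
    fix \<omega>
    define z where "z = driver \<omega>"
    show "B (driver \<omega>) + on_move k (i, n) (drift k) (driver \<omega>) \<le> on_move k (i, n) (pot k) (driver \<omega>)"
    proof (cases "moves_nth k i n z \<and> unmet z k")
      case True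
      hence i: "mover z k = i" by (simp add: moves_nth_def)
      have pos: "0 < fst (snd (lerp_move i rt (chain z k))) v" for rt v
        using weight_pos[of z k] by (auto simp: lerp_move_def add_pos_pos split: prod.split)
      note nonneg = lerp_prob_bounds[OF weight_pos \<Delta>_nonneg]
        lerp_potential_nonneg[OF pos] lerp_drift_nonneg[OF weight_pos \<Delta>_nonneg \<Delta>_less_1]
      have "B z + on_move k (i, n) (drift k) z = ennreal (lerp_prob \<Delta> i (chain z k) * lerp_potential (lerp_move i True (chain z k)) +
          (1 - lerp_prob \<Delta> i (chain z k)) * lerp_potential (lerp_move i False (chain z k)) + lerp_drift \<Delta> i (chain z k))"
        using True nonneg by (simp add: B_def P_def on_move_def drift_def i ennreal_mult ennreal_plus)
      also have "\<dots> \<le> ennreal (lerp_potential (chain z k))"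
        using True by (intro ennreal_leI lerp_potential_supermartingale weight_pos \<Delta>_nonneg \<Delta>_less_1) (simp add: unmet_def)
      also have "\<dots> = on_move k (i, n) (pot k) z" using True by (simp add: on_move_def pot_def)
      finally show ?thesis by (simp add: z_def)
    qed (auto simp: z_def B_def on_move_def drift_def)
  qed
  finally show ?thesis .
qed

lemma pot_decrease:
  "(\<integral>\<^sup>+\<omega>. pot (Suc k) (driver \<omega>) \<partial>M) + (\<integral>\<^sup>+\<omega>. drift k (driver \<omega>) \<partial>M) \<le> (\<integral>\<^sup>+\<omega>. pot k (driver \<omega>) \<partial>M)"
proof -
  have split: "(\<integral>\<^sup>+\<omega>. f (driver \<omega>) \<partial>M) = (\<Sum>p\<in>UNIV \<times> {..k}. \<integral>\<^sup>+\<omega>. on_move k p f (driver \<omega>) \<partial>M)"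
    if f [measurable]: "f \<in> borel_measurable driver_space" for f
  proof -
    have "f z = (\<Sum>p\<in>UNIV \<times> {..k}. on_move k p f z)" for z
    proof -
      \<comment> \<open>Exactly one pair of particle and counter is active at step \<open>k\<close>,
        and its counter is at most \<open>k\<close>, so a finite sum suffices.\<close>
      have "on_move k p f z = (if p = (mover z k, count z k (mover z k)) then f z else 0)" for p
        by (auto simp: on_move_def moves_nth_def split: prod.split)
      moreover have "count z k i \<le> k" for i by (simp add: chain_def lerp_count_le)
      ultimately show ?thesis by simp
    qed
    hence "(\<integral>\<^sup>+\<omega>. f (driver \<omega>) \<partial>M) = (\<integral>\<^sup>+\<omega>. (\<Sum>p\<in>UNIV \<times> {..k}. on_move k p f (driver \<omega>)) \<partial>M)" by simp
    also have "\<dots> = (\<Sum>p\<in>UNIV \<times> {..k}. \<integral>\<^sup>+\<omega>. on_move k p f (driver \<omega>) \<partial>M)"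
      by (rule nn_integral_sum) measurable
    finally show ?thesis .
  qed
  show ?thesis
    unfolding split[OF pot_measurable] split[OF drift_measurable] sum.distrib[symmetric]
    by (rule sum_mono) (use pot_decrease_on[of k] in auto)
qed

text \<open>Iterating the decrease bounds the expected total drift by the initial resistance, so
  almost surely the total drift is finite; \<open>lerp_drift_not_summable\<close> excludes this on
  paths without a meeting.\<close>

lemma AE_meet: "AE \<omega> in M. \<exists>k. \<not> lerp_apart (chain (driver \<omega>) k)"
proof -
  have "(\<integral>\<^sup>+\<omega>. pot n (driver \<omega>) \<partial>M) + (\<Sum>k<n. \<integral>\<^sup>+\<omega>. drift k (driver \<omega>) \<partial>M) \<le> (\<integral>\<^sup>+\<omega>. pot 0 (driver \<omega>) \<partial>M)" for n
  proof (induction n)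
    case (Suc n)
    have "(\<integral>\<^sup>+\<omega>. pot (Suc n) (driver \<omega>) \<partial>M) + (\<Sum>k<Suc n. \<integral>\<^sup>+\<omega>. drift k (driver \<omega>) \<partial>M) =
       ((\<integral>\<^sup>+\<omega>. pot (Suc n) (driver \<omega>) \<partial>M) + (\<integral>\<^sup>+\<omega>. drift n (driver \<omega>) \<partial>M)) + (\<Sum>k<n. \<integral>\<^sup>+\<omega>. drift k (driver \<omega>) \<partial>M)"
      by (simp add: ac_simps)
    also have "\<dots> \<le> (\<integral>\<^sup>+\<omega>. pot n (driver \<omega>) \<partial>M) + (\<Sum>k<n. \<integral>\<^sup>+\<omega>. drift k (driver \<omega>) \<partial>M)"
      by (rule add_right_mono[OF pot_decrease])
    finally show ?case using Suc.IH by (rule order_trans)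
  qed simp
  hence "(\<Sum>k<n. \<integral>\<^sup>+\<omega>. drift k (driver \<omega>) \<partial>M) \<le> (\<integral>\<^sup>+\<omega>. pot 0 (driver \<omega>) \<partial>M)" for n
    by (meson add_increasing order_refl order_trans zero_le)
  hence "(\<Sum>k. \<integral>\<^sup>+\<omega>. drift k (driver \<omega>) \<partial>M) \<le> (\<integral>\<^sup>+\<omega>. pot 0 (driver \<omega>) \<partial>M)"
    by (intro suminf_le_const) auto
  \<comment> \<open>The initial state does not depend on the driving variables, so any point may
    stand for it.\<close>
  also have "(\<integral>\<^sup>+\<omega>. pot 0 (driver \<omega>) \<partial>M) \<le> (\<integral>\<^sup>+\<omega>. ennreal (lerp_potential (chain (\<lambda>_. 0) 0)) \<partial>M)"
    by (rule nn_integral_mono) (simp add: pot_def chain_def)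
  also have "\<dots> < \<infinity>" by (simp add: emeasure_space_1)
  finally have "(\<integral>\<^sup>+\<omega>. (\<Sum>k. drift k (driver \<omega>)) \<partial>M) \<noteq> \<infinity>"
    by (subst nn_integral_suminf) auto
  hence "AE \<omega> in M. (\<Sum>k. drift k (driver \<omega>)) \<noteq> \<infinity>"
    by (rule nn_integral_PInf_AE[rotated]) simp
  thus ?thesis
  proof (rule AE_mp, intro AE_I2 impI)
    fix \<omega>
    assume fin: "(\<Sum>k. drift k (driver \<omega>)) \<noteq> \<infinity>"
    show "\<exists>k. \<not> lerp_apart (chain (driver \<omega>) k)"
    proof (rule ccontr)
      assume "\<not> ?thesis"
      hence apart: "lerp_apart (chain (driver \<omega>) k)" for k by simp
      have "drift k (driver \<omega>) = ennreal (lerp_drift \<Delta> (mover (driver \<omega>) k) (chain (driver \<omega>) k))" for k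
        by (simp add: drift_def unmet_def apart)
      with fin have "summable (\<lambda>k. lerp_drift \<Delta> (mover (driver \<omega>) k) (chain (driver \<omega>) k))"
        by (intro summable_suminf_not_top lerp_drift_nonneg weight_pos \<Delta>_nonneg \<Delta>_less_1) simp
      thus False
        using lerp_drift_not_summable[OF \<Delta>_nonneg \<Delta>_less_1 a_pos] apart
        unfolding mover_def chain_def by blast
    qed
  qed
qed

end

theorem theorem2:
  fixes M :: "'w measure"
    and E U :: "bool \<Rightarrow> nat \<Rightarrow> 'w \<Rightarrow> real"
    and \<Delta> a :: real and l0 r0 :: int
  assumes "prob_space M"
    and "0 \<le> \<Delta>" and "\<Delta> < 1" and "0 < a" and "l0 < r0"
    and "\<And>i k. distributed M lborel (E i k) (exponential_density 1)"
    and "\<And>i k. distributed M lborel (U i k) (indicator {0..1})"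
    and "prob_space.indep_vars M (\<lambda>_. borel)
           (\<lambda>(b, i, k). if b then E i k else U i k) UNIV"
  shows "AE \<omega> in M. lerp_meet_time \<Delta> a l0 r0 (\<lambda>i k. E i k \<omega>) (\<lambda>i k. U i k \<omega>) < \<infinity>"
proof -
  interpret prob_space M by fact
  define Z where "Z = (\<lambda>(b, i, k). if b then E i k else U i k)"
  interpret two_point_lerp_prob M \<Delta> a l0 r0 Z
    using assms by unfold_locales (auto simp: Z_def)
  have Z: "Z (True, i, k) = E i k" "Z (False, i, k) = U i k" for i k by (auto simp: Z_def)
  have "AE \<omega> in M. 0 < E i k \<omega>" for i k
  proof -
    \<comment> \<open>The exponential distribution function at 0 is
      \<open>1 - exp 0\<close>.\<close>
    have "prob {\<omega> \<in> space M. E i k \<omega> \<le> 0} = 0"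
      using exponential_distributedD_le[OF assms(6), of 0] by simp
    moreover have "E i k \<in> borel_measurable M" using assms(6)[of i k] by (simp add: distributed_def)
    ultimately have "AE \<omega> in M. \<not> E i k \<omega> \<le> 0"
      by (subst AE_iff_measurable[OF _ refl]) (auto simp: emeasure_eq_measure)
    thus ?thesis by (simp add: not_le)
  qed
  hence pos: "AE \<omega> in M. \<forall>i k. 0 < E i k \<omega>" by (simp add: AE_all_countable)
  have "AE \<omega> in M. clock (\<lambda>i k. E i k \<omega>) True m \<noteq> clock (\<lambda>i k. E i k \<omega>) False n" for m n
    using AE_clocks_distinct[OF indep, of m n] assms(6) by (simp add: Z)
  hence ties: "AE \<omega> in M. \<forall>m n. clock (\<lambda>i k. E i k \<omega>) True m \<noteq> clock (\<lambda>i k. E i k \<omega>) False n"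
    by (simp add: AE_all_countable)
  show ?thesis
    using pos ties AE_meet
    by eventually_elim (rule lerp_meet_time_finite, use assms(5) in \<open>auto simp: chain_def Z\<close>)
qed

end
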